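(* Let $b$ be a timelike four-vector, let $\phi_{\mu\nu}$ be a real antisymmetric tensor, and let $\Lambda=\exp(\phi)$ be the Lorentz transformation generated by the matrix $\phi^\mu{}_\nu$. Put $$\tilde b=\sum_{k=0}^\infty\frac{\phi^kb}{(k+1)!},\qquad \tilde b_n=\sum_{k=0}^\infty\frac{(-n\phi)^kb}{(k+1)!}\quad(n\ge1).$$ Then the series $$S(p,p')=2\varepsilon'\sum_{n=1}^\infty\delta^3(\Lambda^n\mathbf p-\mathbf p')\,\exp\Big[-\sum_{k=1}^n(\Lambda^{-k}\tilde b)\cdot p\Big],$$ which can equivalently be written as $$S(p,p')=2\varepsilon'\sum_{n=1}^\infty\delta^3(\Lambda^n\mathbf p-\mathbf p')\,\exp\big[-n\,\tilde b_n\cdot p\big],$$ is a solution of the equation $$S(p,p')=e^{-\tilde b\cdot\Lambda p}\,S(\Lambda p,p')+2\varepsilon'\,\delta^3(\Lambda\mathbf p-\mathbf p')\,e^{-\tilde b\cdot p'} .$$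
   Context: The metric is $\mathrm{diag}(1,-1,-1,-1)$, the dot is the Minkowski product, and $(\phi b)^\mu=\phi^\mu{}_\nu b^\nu$. The momenta $p=(\varepsilon,\mathbf p)$ and $p'=(\varepsilon',\mathbf p')$ are on the mass shell, $\varepsilon=\sqrt{\mathbf p^2+m^2}$, $\varepsilon'=\sqrt{\mathbf p'^2+m^2}$; $\Lambda^n\mathbf p$ denotes the spatial part of the four-vector $\Lambda^np$. $S(p,p')$ represents the expectation value $\langle\hat a^\dagger(p)\,\hat a(p')\rangle$ of creation and annihilation operators of a free scalar field, normalized by $[\hat a(p),\hat a^\dagger(p')]=2\varepsilon'\delta^3(\mathbf p-\mathbf p')$, computed with the operator $\frac1Z\exp[-b\cdot\widehat P+\frac12\varpi:\widehat J\,]$ ($\widehat P,\widehat J$ the Poincaré generators) at imaginary $\varpi=-i\phi$.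
   Formalization: For past-directed timelike b the series can diverge (e.g. φ=0), so there the equation is asserted only when the series, tested in p' against a continuous compactly supported function, converges; for future-directed b convergence and the equation hold unconditionally. *)

theory Defs
  imports "HOL-Analysis.Analysis"
begin

section \<open>Minkowski space\<close>

text \<open>Four-vectors are indexed by \<open>0, 1, 2, 3 :: 4\<close>, with \<open>0\<close> the time index (recall \<open>(4 :: 4) = 0\<close>);
  three-vectors are indexed by \<open>1, 2, 3 :: 3\<close>.\<close>

type_synonym fourvec = "real ^ 4"
type_synonym threevec = "real ^ 3"

definition metric :: "real ^ 4 ^ 4" where
  "metric = (\<chi> \<mu> \<nu>. if \<mu> = \<nu> then (if \<mu> = 0 then 1 else - 1) else 0)"

definition minkowski :: "fourvec \<Rightarrow> fourvec \<Rightarrow> real" where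
  "minkowski x y = x \<bullet> (metric *v y)"

definition timelike :: "fourvec \<Rightarrow> bool" where
  "timelike x \<longleftrightarrow> minkowski x x > 0"

definition antisymmetric :: "real ^ 4 ^ 4 \<Rightarrow> bool" where
  "antisymmetric \<phi> \<longleftrightarrow> (\<forall>\<mu> \<nu>. \<phi> $ \<mu> $ \<nu> = - (\<phi> $ \<nu> $ \<mu>))"

text \<open>\<open>\<phi> $ \<mu> $ \<nu>\<close> has both indices down; \<open>mixed \<phi>\<close> has the first one raised (the metric is its own inverse).\<close>

definition mixed :: "real ^ 4 ^ 4 \<Rightarrow> real ^ 4 ^ 4" where
  "mixed \<phi> = metric ** \<phi>"

primrec mat_pow :: "real ^ 'n ^ 'n \<Rightarrow> nat \<Rightarrow> real ^ 'n ^ 'n" where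
  "mat_pow A 0 = mat 1"
| "mat_pow A (Suc k) = A ** mat_pow A k"

definition mat_exp :: "real ^ 'n ^ 'n \<Rightarrow> real ^ 'n ^ 'n" where
  "mat_exp A = (\<Sum>k. (1 / fact k) *\<^sub>R mat_pow A k)"

definition lorentz :: "real ^ 4 ^ 4 \<Rightarrow> real ^ 4 ^ 4" where
  "lorentz \<phi> = mat_exp (mixed \<phi>)"

definition averaged :: "real ^ 4 ^ 4 \<Rightarrow> fourvec \<Rightarrow> fourvec" where
  "averaged A b = (\<Sum>k. (1 / fact (k + 1)) *\<^sub>R (mat_pow A k *v b))"

definition btilde :: "real ^ 4 ^ 4 \<Rightarrow> fourvec \<Rightarrow> fourvec" where
  "btilde \<phi> b = averaged (mixed \<phi>) b"

definition btilde_n :: "real ^ 4 ^ 4 \<Rightarrow> fourvec \<Rightarrow> nat \<Rightarrow> fourvec" where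
  "btilde_n \<phi> b n = averaged ((- real n) *\<^sub>R mixed \<phi>) b"

definition spatial :: "fourvec \<Rightarrow> threevec" where
  "spatial x = (\<chi> i. if i = 1 then x $ 1 else if i = 2 then x $ 2 else x $ 3)"

definition energy :: "real \<Rightarrow> threevec \<Rightarrow> real" where
  "energy m q = sqrt (q \<bullet> q + m\<^sup>2)"

definition shell_vec :: "real \<Rightarrow> threevec \<Rightarrow> fourvec" where
  "shell_vec m q = (\<chi> \<mu>. if \<mu> = 0 then energy m q else if \<mu> = 1 then q $ 1
                        else if \<mu> = 2 then q $ 2 else q $ 3)"

definition on_shell :: "real \<Rightarrow> fourvec \<Rightarrow> bool" where
  "on_shell m p \<longleftrightarrow> p $ 0 = energy m (spatial p)"

section \<open>Distributions in the variable p'\<close>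

text \<open>For each fixed on-shell \<open>p\<close>, a kernel such as \<open>S(p, p')\<close> is a distribution in the three-momentum
  \<open>p'\<close>, that is, a functional \<open>f \<mapsto> \<integral> S(p, p') f(p') d\<^sup>3p'\<close>.  All distributions
  here have order zero, so they are tested on continuous functions of compact support, a larger
  class than the smooth ones.  Only values on such functions are meaningful.\<close>

type_synonym distribution = "(threevec \<Rightarrow> real) \<Rightarrow> real"

definition test_function :: "(threevec \<Rightarrow> real) \<Rightarrow> bool" where
  "test_function f \<longleftrightarrow> continuous_on UNIV f \<and> compact (closure {x. f x \<noteq> 0})"

text \<open>\<open>delta a\<close> is \<open>\<delta>\<^sup>3(a - p')\<close>.\<close>

definition delta :: "threevec \<Rightarrow> distribution" where
  "delta a f = f a"

definition fun_times :: "(threevec \<Rightarrow> real) \<Rightarrow> distribution \<Rightarrow> distribution" where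
  "fun_times h T f = T (\<lambda>x. h x * f x)"

section \<open>The series and the equation\<close>

text \<open>The prefactor \<open>2\<epsilon>'\<close> is placed inside the sums: for \<open>m = 0\<close> it vanishes at the origin and is
  needed for convergence.\<close>

definition S_term :: "real \<Rightarrow> fourvec \<Rightarrow> real ^ 4 ^ 4 \<Rightarrow> fourvec \<Rightarrow> nat \<Rightarrow> distribution" where
  "S_term m b \<phi> p n f =
     exp (- (\<Sum>k = 1..n. minkowski (mat_pow (matrix_inv (lorentz \<phi>)) k *v btilde \<phi> b) p))
     * fun_times (\<lambda>p'. 2 * energy m p') (delta (spatial (mat_pow (lorentz \<phi>) n *v p))) f"

definition S_term_alt :: "real \<Rightarrow> fourvec \<Rightarrow> real ^ 4 ^ 4 \<Rightarrow> fourvec \<Rightarrow> nat \<Rightarrow> distribution" where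
  "S_term_alt m b \<phi> p n f =
     exp (- (real n * minkowski (btilde_n \<phi> b n) p))
     * fun_times (\<lambda>p'. 2 * energy m p') (delta (spatial (mat_pow (lorentz \<phi>) n *v p))) f"

definition S_convergent :: "real \<Rightarrow> fourvec \<Rightarrow> real ^ 4 ^ 4 \<Rightarrow> fourvec \<Rightarrow> (threevec \<Rightarrow> real) \<Rightarrow> bool" where
  "S_convergent m b \<phi> p f \<longleftrightarrow> summable (\<lambda>n. S_term m b \<phi> p (Suc n) f)"

definition S :: "real \<Rightarrow> fourvec \<Rightarrow> real ^ 4 ^ 4 \<Rightarrow> fourvec \<Rightarrow> distribution" where
  "S m b \<phi> p f = (\<Sum>n. S_term m b \<phi> p (Suc n) f)"

definition S_alt :: "real \<Rightarrow> fourvec \<Rightarrow> real ^ 4 ^ 4 \<Rightarrow> fourvec \<Rightarrow> distribution" where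
  "S_alt m b \<phi> p f = (\<Sum>n. S_term_alt m b \<phi> p (Suc n) f)"

text \<open>The equation for an unknown kernel \<open>T\<close>, at the momentum \<open>p\<close> and tested against \<open>f\<close>.\<close>

definition equation_at ::
  "real \<Rightarrow> fourvec \<Rightarrow> real ^ 4 ^ 4 \<Rightarrow> (fourvec \<Rightarrow> distribution) \<Rightarrow> fourvec \<Rightarrow> (threevec \<Rightarrow> real) \<Rightarrow> bool" where
  "equation_at m b \<phi> T p f \<longleftrightarrow>
     T p f = exp (- minkowski (btilde \<phi> b) (lorentz \<phi> *v p)) * T (lorentz \<phi> *v p) f
           + fun_times (\<lambda>p'. 2 * energy m p' * exp (- minkowski (btilde \<phi> b) (shell_vec m p')))
               (delta (spatial (lorentz \<phi> *v p))) f"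

end

theory Submission
  imports Defs
begin

text \<open>Write \<open>A\<close> for the mixed tensor and \<open>\<Lambda>\<^sup>s = exp (s A)\<close>. Since \<open>A\<close> is skew for the Minkowski
  product, \<open>\<Lambda>\<^sup>s\<close> is an isometry, so the \<open>n\<close>-th exponent is \<open>\<Sum>k=1..n. btilde \<cdot> \<Lambda>\<^sup>k p\<close>. Hence the
  \<open>n+1\<close>-st term at \<open>p\<close> is \<open>exp (- btilde \<cdot> \<Lambda>p)\<close> times the \<open>n\<close>-th term at \<open>\<Lambda>p\<close>, which is the equation.
  Because \<open>btilde\<close> is the integral of \<open>\<Lambda>\<^sup>s b\<close> over \<open>[0,1]\<close>, the exponent also equals the integral of
  \<open>b \<cdot> \<Lambda>\<^sup>s p\<close> over \<open>[0,n]\<close>, which is \<open>n btilde_n \<cdot> p\<close>.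

  For convergence, the vectors \<open>\<Lambda>\<^sup>s b\<close> with \<open>s \<in> [0,1]\<close> form a compact set in the open future cone, so
  \<open>btilde \<cdot> q \<ge> c q\<^sup>0\<close> for all on-shell \<open>q\<close>, with some \<open>c > 0\<close>. With \<open>\<epsilon>\<^sub>k\<close> the energy of \<open>\<Lambda>\<^sup>k p\<close>, the
  \<open>n\<close>-th term is at most a constant times \<open>\<epsilon>\<^sub>n exp (- c (\<epsilon>\<^sub>1 + \<dots> + \<epsilon>\<^sub>n))\<close>, which is summable without any
  lower bound on the energies; this covers \<open>m = 0\<close>.\<close>

section \<open>Exponential generating functions with vector coefficients\<close>

definition geometrically_bounded :: "(nat \<Rightarrow> 'a::real_normed_vector) \<Rightarrow> bool" where
  "geometrically_bounded c \<longleftrightarrow> (\<exists>C K. \<forall>k. norm (c k) \<le> C * K ^ k)"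

text \<open>One series serves for the matrix exponential, the orbits \<open>mat_pow A k *v x\<close>
  and their integrals, which differ only in the coefficients.\<close>

definition egf :: "(nat \<Rightarrow> 'a::real_normed_vector) \<Rightarrow> real \<Rightarrow> 'a" where
  "egf c s = (\<Sum>k. (s ^ k / fact k) *\<^sub>R c k)"

lemma geometrically_bounded_Suc:
  assumes "geometrically_bounded c"
  shows "geometrically_bounded (\<lambda>k. c (Suc k))"
proof -
  obtain C K where "norm (c k) \<le> C * K ^ k" for k
    using assms unfolding geometrically_bounded_def by blast
  then have "norm (c (Suc k)) \<le> (C * K) * K ^ k" for k
    by (metis mult.assoc power_Suc)
  then show ?thesis
    unfolding geometrically_bounded_def by blast
qed

text \<open>Prepending a zero coefficient integrates the series from \<open>0\<close>, so integrals
  stay in the class.\<close>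

lemma geometrically_bounded_case_nat:
  assumes "geometrically_bounded c"
  shows "geometrically_bounded (case_nat 0 c)"
proof -
  obtain C K where CK: "norm (c k) \<le> C * K ^ k" for k
    using assms unfolding geometrically_bounded_def by blast
  define D where "D = \<bar>C\<bar>"
  \<comment> \<open>A base of at least \<open>1\<close> lets the bound pass from index
    \<open>j\<close> to index \<open>j + 1\<close>.\<close>
  define L where "L = \<bar>K\<bar> + 1"
  have "norm (case_nat 0 c k) \<le> D * L ^ k" for k
  proof (cases k)
    case (Suc j)
    have "norm (c j) \<le> \<bar>C\<bar> * \<bar>K\<bar> ^ j"
      using CK[of j] by (metis abs_ge_self abs_mult order_trans power_abs)
    also have "\<dots> \<le> D * L ^ k"
      unfolding D_def L_def Suc
      by (intro mult_left_mono order_trans[OF power_mono[of _ "\<bar>K\<bar> + 1"] power_increasing]) auto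
    finally show ?thesis by (simp add: Suc)
  qed (simp add: D_def)
  then show ?thesis
    unfolding geometrically_bounded_def by blast
qed

lemma geometrically_bounded_linear_iterates:
  assumes "bounded_linear F" and "\<And>k. c (Suc k) = F (c k)"
  shows "geometrically_bounded c"
proof -
  interpret bounded_linear F by fact
  obtain K where K: "K > 0" "\<And>x. norm (F x) \<le> norm x * K"
    using pos_bounded by blast
  have "norm (c k) \<le> norm (c 0) * K ^ k" for k
  proof (induction k)
    case (Suc k)
    have "norm (c (Suc k)) \<le> norm (c k) * K"
      using K assms(2) by simp
    also have "\<dots> \<le> norm (c 0) * K ^ k * K"
      using Suc K by (simp add: mult_right_mono)
    finally show ?case by (simp add: mult_ac)
  qed simp
  then show ?thesis
    unfolding geometrically_bounded_def by blast
qed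

lemma summable_egf:
  fixes c :: "nat \<Rightarrow> 'a::banach"
  assumes "geometrically_bounded c"
  shows "summable (\<lambda>k. (s ^ k / fact k) *\<^sub>R c k)"
proof -
  obtain C K where CK: "norm (c k) \<le> C * K ^ k" for k
    using assms unfolding geometrically_bounded_def by blast
  have "summable (\<lambda>k. C * (inverse (fact k) * (\<bar>s\<bar> * K) ^ k))"
    by (intro summable_mult summable_exp)
  moreover have "norm ((s ^ k / fact k) *\<^sub>R c k) \<le> C * (inverse (fact k) * (\<bar>s\<bar> * K) ^ k)" for k
    using mult_left_mono[OF CK[of k], of "\<bar>s\<bar> ^ k / fact k"]
    by (simp add: power_abs power_mult_distrib field_simps)
  ultimately show ?thesis
    by (rule summable_comparison_test'[where N=0])
qed

lemma egf_sums:
  fixes c :: "nat \<Rightarrow> 'a::banach"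
  assumes "geometrically_bounded c"
  shows "(\<lambda>k. (s ^ k / fact k) *\<^sub>R c k) sums egf c s"
  unfolding egf_def by (rule summable_sums[OF summable_egf[OF assms]])

lemma egf_0 [simp]: "egf c 0 = c 0"
proof -
  have "(\<lambda>k. (0 ^ k / fact k) *\<^sub>R c k) = (\<lambda>k. if k = 0 then c 0 else 0)"
    by (auto simp: fun_eq_iff)
  then show ?thesis
    unfolding egf_def using sums_single[of 0 "\<lambda>_. c 0"] by (simp add: sums_iff)
qed

lemma egf_bounded_linear:
  fixes c :: "nat \<Rightarrow> 'a::banach"
  assumes "bounded_linear F" and "geometrically_bounded c"
  shows "F (egf c s) = egf (\<lambda>k. F (c k)) s"
  using bounded_linear.sums[OF assms(1) egf_sums[OF assms(2)]]
  unfolding egf_def[of "\<lambda>k. F (c k)"]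
  by (simp add: sums_iff linear_cmul[OF bounded_linear.linear[OF assms(1)]])

text \<open>Differentiation shifts the coefficients; componentwise this is termwise differentiation
  of an everywhere convergent real power series.\<close>

lemma has_vector_derivative_egf:
  fixes c :: "nat \<Rightarrow> 'a::euclidean_space"
  assumes c: "geometrically_bounded c"
  shows "(egf c has_vector_derivative egf (\<lambda>k. c (Suc k)) s) (at s)"
  unfolding has_vector_derivative_def
proof (subst has_derivative_componentwise_within, rule ballI)
  fix i :: 'a assume "i \<in> Basis"
  define d where "d k = (c k \<bullet> i) / fact k" for k
  note lin = bounded_linear_inner_left[of i]
  have d_sums: "(\<lambda>k. d k * y ^ k) sums (egf c y \<bullet> i)" for y
    using bounded_linear.sums[OF lin egf_sums[OF c]] by (simp add: d_def mult_ac)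
  have "diffs d = (\<lambda>k. (c (Suc k) \<bullet> i) / fact k)"
    by (auto simp: diffs_def d_def fun_eq_iff field_simps simp del: of_nat_Suc)
  then have "(\<lambda>k. diffs d k * s ^ k) sums (egf (\<lambda>k. c (Suc k)) s \<bullet> i)"
    using bounded_linear.sums[OF lin egf_sums[OF geometrically_bounded_Suc[OF c]]]
    by (simp add: mult_ac)
  moreover have "((\<lambda>x. \<Sum>k. d k * x ^ k) has_field_derivative (\<Sum>k. diffs d k * s ^ k)) (at s)"
    using d_sums by (intro termdiffs_strong_converges_everywhere) (auto simp: sums_iff)
  moreover have "(\<lambda>x. \<Sum>k. d k * x ^ k) = (\<lambda>x. egf c x \<bullet> i)"
    using d_sums by (auto simp: sums_iff)
  ultimately have "((\<lambda>x. egf c x \<bullet> i) has_field_derivative (egf (\<lambda>k. c (Suc k)) s \<bullet> i)) (at s)"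
    by (simp add: sums_iff)
  then show "((\<lambda>x. egf c x \<bullet> i) has_derivative (\<lambda>x. (x *\<^sub>R egf (\<lambda>k. c (Suc k)) s) \<bullet> i)) (at s)"
    by (simp add: has_field_derivative_def mult_commute_abs)
qed

section \<open>The one-parameter group of a matrix\<close>

definition flow :: "real ^ 'n ^ 'n \<Rightarrow> real \<Rightarrow> real ^ 'n \<Rightarrow> real ^ 'n" where
  "flow A s x = egf (\<lambda>k. mat_pow A k *v x) s"

text \<open>The integral of \<open>flow A r x\<close> over \<open>r\<close> from \<open>0\<close> to
  \<open>s\<close>, encoded by shifted coefficients so that it can be compared termwise with
  \<open>averaged\<close>.\<close>

definition flow_integral :: "real ^ 'n ^ 'n \<Rightarrow> real \<Rightarrow> real ^ 'n \<Rightarrow> real ^ 'n" where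
  "flow_integral A s x = egf (case_nat 0 (\<lambda>k. mat_pow A k *v x)) s"

lemma geometrically_bounded_orbit: "geometrically_bounded (\<lambda>k. mat_pow A k *v x)"
  by (rule geometrically_bounded_linear_iterates[of "(*v) A"])
    (simp_all add: matrix_vector_mul_assoc)

lemma flow_0 [simp]: "flow A 0 x = x"
  by (simp add: flow_def)

lemma flow_integral_0 [simp]: "flow_integral A 0 x = 0"
  by (simp add: flow_integral_def)

lemma flow_has_vector_derivative:
  "((\<lambda>s. flow A s x) has_vector_derivative A *v flow A s x) (at s)"
proof -
  have "A *v flow A s x = egf (\<lambda>k. mat_pow A (Suc k) *v x) s"
    unfolding flow_def
    by (simp add: egf_bounded_linear[OF _ geometrically_bounded_orbit] matrix_vector_mul_assoc)
  then show ?thesis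
    using has_vector_derivative_egf[OF geometrically_bounded_orbit, of A x s]
    by (simp add: flow_def)
qed

lemma flow_integral_has_vector_derivative:
  "((\<lambda>s. flow_integral A s x) has_vector_derivative flow A s x) (at s)"
  using has_vector_derivative_egf[OF geometrically_bounded_case_nat[OF geometrically_bounded_orbit], of A x s]
  by (simp add: flow_integral_def flow_def)

lemma mat_exp_mult_vec: "mat_exp A *v x = flow A 1 x"
proof -
  have "linear (\<lambda>M. A ** M)"
    by (rule linearI) (simp_all add: matrix_add_ldistrib matrix_scalar_ac scalar_matrix_assoc)
  then have "geometrically_bounded (mat_pow A)"
    by (intro geometrically_bounded_linear_iterates[of "\<lambda>M. A ** M"])
      (simp_all add: linear_conv_bounded_linear)
  moreover have "bounded_linear (\<lambda>M. M *v x)"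
    unfolding linear_conv_bounded_linear[symmetric]
    by (rule linearI) (simp_all add: matrix_vector_mult_add_rdistrib scaleR_matrix_vector_assoc)
  ultimately have "egf (mat_pow A) 1 *v x = egf (\<lambda>k. mat_pow A k *v x) 1"
    by (rule egf_bounded_linear[rotated])
  then show ?thesis
    by (simp add: mat_exp_def egf_def flow_def)
qed

lemma averaged_eq_flow_integral: "averaged A x = flow_integral A 1 x"
proof -
  have "(\<lambda>k. (1 ^ k / fact k) *\<^sub>R case_nat 0 (\<lambda>k. mat_pow A k *v x) k) sums flow_integral A 1 x"
    unfolding flow_integral_def
    by (rule egf_sums[OF geometrically_bounded_case_nat[OF geometrically_bounded_orbit]])
  then have "(\<lambda>k. (1 / fact (Suc k)) *\<^sub>R (mat_pow A k *v x)) sums flow_integral A 1 x"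
    using sums_Suc_iff[of "\<lambda>k. (1 ^ k / fact k) *\<^sub>R case_nat 0 (\<lambda>k. mat_pow A k *v x) k" "flow_integral A 1 x"]
    by simp
  then show ?thesis
    by (simp add: averaged_def sums_iff)
qed

section \<open>Minkowski geometry\<close>

lemma metric_mult_vec: "(metric *v y) $ \<mu> = (if \<mu> = 0 then y $ \<mu> else - (y $ \<mu>))"
proof -
  have "metric $ \<mu> $ \<nu> * y $ \<nu> = (if \<mu> = \<nu> then if \<mu> = 0 then y $ \<mu> else - (y $ \<mu>) else 0)" for \<nu>
    by (simp add: metric_def)
  then show ?thesis
    by (simp add: matrix_vector_mult_def)
qed

lemma minkowski_eq: "minkowski x y = x $ 0 * y $ 0 - spatial x \<bullet> spatial y"
proof -
  have [simp]: "(4::4) = 0" by simp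
  show ?thesis
    by (simp add: minkowski_def metric_mult_vec inner_vec_def sum_4 sum_3 spatial_def)
qed

lemma bounded_bilinear_minkowski: "bounded_bilinear minkowski"
  unfolding minkowski_def
  by (rule bounded_bilinear.comp[OF bounded_bilinear_inner bounded_linear_ident])
    (rule matrix_vector_mul_bounded_linear)

interpretation minkowski: bounded_bilinear minkowski
  by (rule bounded_bilinear_minkowski)

lemma linear_spatial: "linear spatial"
  by (rule linearI) (simp_all add: spatial_def vec_eq_iff)

lemma minkowski_nondegenerate:
  assumes "\<And>x. minkowski x y = minkowski x z"
  shows "y = z"
proof -
  \<comment> \<open>The product here is the squared Euclidean norm of
    \<open>metric *v (y - z)\<close>.\<close>
  have "minkowski (metric *v (y - z)) (y - z) = 0"
    by (simp add: minkowski.diff_right assms)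
  then have "(metric *v (y - z)) $ \<mu> = 0" for \<mu>
    by (simp add: minkowski_def)
  then have "(y - z) $ \<mu> = 0" for \<mu>
    unfolding metric_mult_vec by (metis neg_equal_0_iff_equal)
  then show ?thesis
    by (simp add: vec_eq_iff)
qed

lemma timelike_iff: "timelike x \<longleftrightarrow> norm (spatial x) < \<bar>x $ 0\<bar>"
proof -
  have "timelike x \<longleftrightarrow> (norm (spatial x))\<^sup>2 < (x $ 0)\<^sup>2"
    by (simp add: timelike_def minkowski_eq power2_norm_eq_inner power2_eq_square[of "x $ 0"])
  then show ?thesis
    by (metis abs_norm_cancel abs_le_square_iff linorder_not_le)
qed

text \<open>Splits the shell condition into an invariant square and the sign of the energy, whose
  preservation is proved separately.\<close>

lemma on_shell_iff: "on_shell m q \<longleftrightarrow> q $ 0 \<ge> 0 \<and> minkowski q q = m\<^sup>2"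
proof
  assume "on_shell m q"
  then show "q $ 0 \<ge> 0 \<and> minkowski q q = m\<^sup>2"
    by (simp add: on_shell_def energy_def minkowski_eq flip: power2_eq_square)
next
  assume q: "q $ 0 \<ge> 0 \<and> minkowski q q = m\<^sup>2"
  then have "spatial q \<bullet> spatial q + m\<^sup>2 = (q $ 0)\<^sup>2"
    by (simp add: minkowski_eq power2_eq_square)
  with q show "on_shell m q"
    by (simp add: on_shell_def energy_def)
qed

lemma shell_vec_spatial:
  assumes "on_shell m q"
  shows "shell_vec m (spatial q) = q"
proof -
  have [simp]: "(4::4) = 0" by simp
  show ?thesis
    using assms UNIV_4 by (auto simp: shell_vec_def spatial_def on_shell_def vec_eq_iff forall_4)
qed

lemma norm_spatial_le_of_causal:
  assumes "minkowski q q \<ge> 0"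
  shows "norm (spatial q) \<le> \<bar>q $ 0\<bar>"
proof -
  have "(norm (spatial q))\<^sup>2 \<le> (q $ 0)\<^sup>2"
    using assms by (simp add: minkowski_eq power2_norm_eq_inner power2_eq_square[of "q $ 0"])
  then show ?thesis
    by (simp add: abs_le_square_iff[symmetric])
qed

text \<open>Cauchy-Schwarz on the spatial parts. For future timelike \<open>u\<close> the factor is
  positive, so the product controls the energy of \<open>q\<close>.\<close>

lemma minkowski_ge_gap:
  assumes "minkowski q q \<ge> 0" and "q $ 0 \<ge> 0"
  shows "(u $ 0 - norm (spatial u)) * q $ 0 \<le> minkowski u q"
proof -
  have "spatial u \<bullet> spatial q \<le> norm (spatial u) * norm (spatial q)"
    by (rule norm_cauchy_schwarz)
  also have "\<dots> \<le> norm (spatial u) * q $ 0"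
    using norm_spatial_le_of_causal[OF assms(1)] assms(2) by (intro mult_left_mono) auto
  finally show ?thesis
    by (simp add: minkowski_eq algebra_simps)
qed

section \<open>Lorentz flows\<close>

locale minkowski_skew =
  fixes A :: "real ^ 4 ^ 4"
  assumes skew: "minkowski (A *v x) y = - minkowski x (A *v y)"
begin

text \<open>Skewness makes the derivative in \<open>s\<close> vanish, so the value at
  \<open>s\<close> is the value at \<open>0\<close>. The offset \<open>t\<close> is what later
  yields the group law.\<close>

lemma minkowski_flow_flow:
  "minkowski (flow A s x) (flow A (t + s) y) = minkowski x (flow A t y)"
proof -
  have shift: "((\<lambda>s. flow A (t + s) y) has_vector_derivative A *v flow A (t + s) y) (at s)" for s
  proof -
    have "((\<lambda>s. t + s) has_vector_derivative 1) (at s)"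
      by (auto intro!: derivative_eq_intros)
    from vector_diff_chain_at[OF this flow_has_vector_derivative] show ?thesis
      by (simp add: o_def)
  qed
  have "((\<lambda>s. minkowski (flow A s x) (flow A (t + s) y)) has_vector_derivative 0) (at s)" for s
    using minkowski.has_vector_derivative[OF flow_has_vector_derivative[of A x s] shift[of s]]
    by (simp add: skew)
  then obtain c where "minkowski (flow A s x) (flow A (t + s) y) = c" for s
    by (rule has_vector_derivative_zero_constant[OF convex_UNIV]) auto
  from this[of s] this[of 0] show ?thesis
    by simp
qed

lemma minkowski_flow [simp]: "minkowski (flow A s x) (flow A s y) = minkowski x y"
  using minkowski_flow_flow[of s x 0 y] by simp

lemma minkowski_flow_left: "minkowski (flow A s x) y = minkowski x (flow A (- s) y)"
  using minkowski_flow_flow[of s x "- s" y] by simp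

text \<open>Follows from the isometry and nondegeneracy, with no multiplication of exponential
  series.\<close>

lemma flow_add: "flow A (s + t) y = flow A s (flow A t y)"
proof (rule minkowski_nondegenerate)
  fix x
  have "minkowski x (flow A (s + t) y) = minkowski (flow A (- s) x) (flow A t y)"
    using minkowski_flow_flow[of "- s" x "s + t" y] by simp
  then show "minkowski x (flow A (s + t) y) = minkowski x (flow A s (flow A t y))"
    by (simp add: minkowski_flow_left)
qed

lemma mat_pow_mat_exp: "mat_pow (mat_exp A) n *v x = flow A (real n) x"
  by (induction n)
    (simp_all add: mat_exp_mult_vec flow_add[symmetric] matrix_vector_mul_assoc[symmetric] add.commute)

text \<open>\<open>matrix_inv\<close> is defined by choice, so a two-sided inverse must first be
  exhibited; injectivity comes from the flow at time \<open>- 1\<close>.\<close>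

lemma mat_exp_matrix_inv: "mat_exp A *v (matrix_inv (mat_exp A) *v x) = x"
proof -
  have "inj ((*v) (mat_exp A))"
  proof (rule injI)
    fix x y assume "mat_exp A *v x = mat_exp A *v y"
    then have "flow A (- 1) (flow A 1 x) = flow A (- 1) (flow A 1 y)"
      by (simp add: mat_exp_mult_vec)
    then show "x = y"
      by (simp flip: flow_add)
  qed
  then obtain B where "B ** mat_exp A = mat 1"
    using matrix_left_invertible_injective by blast
  then have "\<exists>B. mat_exp A ** B = mat 1 \<and> B ** mat_exp A = mat 1"
    using matrix_left_right_inverse by blast
  then have "mat_exp A ** matrix_inv (mat_exp A) = mat 1"
    unfolding matrix_inv_def by (metis (mono_tags, lifting) someI_ex)
  then show ?thesis
    by (simp add: matrix_vector_mul_assoc)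
qed

text \<open>Applying the isometry \<open>mat_exp A\<close> to both arguments cancels one inverse
  factor and advances \<open>y\<close> by one unit of time.\<close>

lemma minkowski_inverse_power:
  "minkowski (mat_pow (matrix_inv (mat_exp A)) k *v x) y = minkowski x (flow A (real k) y)"
proof (induction k arbitrary: y)
  case (Suc k)
  let ?B = "matrix_inv (mat_exp A)"
  have "minkowski (mat_pow ?B (Suc k) *v x) y
      = minkowski (mat_exp A *v (?B *v (mat_pow ?B k *v x))) (flow A 1 y)"
    unfolding mat_exp_mult_vec minkowski_flow by (simp add: matrix_vector_mul_assoc)
  also have "\<dots> = minkowski x (flow A (real (Suc k)) y)"
    by (simp add: mat_exp_matrix_inv Suc.IH flow_add[symmetric] add.commute)
  finally show ?case .
qed simp

section \<open>Invariance of the future cone and of the mass shell\<close>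

lemma flow_future:
  assumes "timelike u" and "u $ 0 > 0"
  shows "flow A s u $ 0 > 0"
proof (rule ccontr)
  assume neg: "\<not> flow A s u $ 0 > 0"
  have "continuous_on UNIV (\<lambda>r. flow A r u)"
    by (intro continuous_at_imp_continuous_on ballI)
      (rule has_vector_derivative_continuous[OF flow_has_vector_derivative])
  then have "connected (range (\<lambda>r. flow A r u $ 0))"
    by (intro connected_continuous_image continuous_on_component) auto
  moreover have "u $ 0 \<in> range (\<lambda>r. flow A r u $ 0)"
    by (rule range_eqI[of _ _ 0]) simp
  \<comment> \<open>By continuity a sign change forces a zero of the time component, which a
    timelike vector cannot have.\<close>
  ultimately have "0 \<in> range (\<lambda>r. flow A r u $ 0)"
    using connectedD_interval[of _ "flow A s u $ 0" "u $ 0" 0] neg assms(2) by auto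
  then obtain r where "flow A r u $ 0 = 0"
    by auto
  moreover have "timelike (flow A r u)"
    using assms(1) by (simp add: timelike_def)
  ultimately show False
    by (simp add: timelike_iff)
qed

text \<open>The energy sign is read off from the product with a transported rest vector
  \<open>v\<close>. This also handles lightlike or zero \<open>p\<close>, to which
  \<open>flow_future\<close> does not apply.\<close>

lemma on_shell_flow:
  assumes "on_shell m p"
  shows "on_shell m (flow A s p)"
proof -
  define q where "q = flow A s p"
  define u :: fourvec where "u = axis 0 1"
  have u: "u $ 0 = 1" "spatial u = 0"
    by (simp_all add: u_def spatial_def vec_eq_iff axis_def)
  then have "timelike u"
    by (simp add: timelike_iff)
  define v where "v = flow A s u"
  have p: "p $ 0 \<ge> 0" "minkowski p p = m\<^sup>2"
    using assms by (simp_all add: on_shell_iff)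
  have q: "minkowski q q = m\<^sup>2"
    using p by (simp add: q_def)
  have "minkowski v q \<ge> 0"
    unfolding v_def q_def minkowski_flow using p u by (simp add: minkowski_eq)
  have v: "norm (spatial v) < v $ 0"
  proof -
    have "timelike v"
      using \<open>timelike u\<close> by (simp add: v_def timelike_def)
    then show ?thesis
      using flow_future[OF \<open>timelike u\<close>, of s] u by (simp add: v_def timelike_iff)
  qed
  have "q $ 0 \<ge> 0"
  proof (rule ccontr)
    assume "\<not> q $ 0 \<ge> 0"
    then have "(v $ 0 - norm (spatial v)) * (- q) $ 0 \<le> minkowski v (- q)"
      using q by (intro minkowski_ge_gap) (simp_all add: minkowski.minus_left minkowski.minus_right)
    moreover have "(v $ 0 - norm (spatial v)) * (- q) $ 0 > 0"
      using v \<open>\<not> q $ 0 \<ge> 0\<close> by (intro mult_pos_pos) auto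
    ultimately show False
      using \<open>minkowski v q \<ge> 0\<close> by (simp add: minkowski.minus_right)
  qed
  with q show ?thesis
    by (simp add: on_shell_iff q_def)
qed

section \<open>Lower bound for the exponent by the energy\<close>

lemma flow_integral_coercive:
  assumes "timelike b" and "b $ 0 > 0"
  obtains c where "c > 0"
    and "\<And>m q. on_shell m q \<Longrightarrow> c * q $ 0 \<le> minkowski (flow_integral A 1 b) q"
proof -
  define gap where "gap s = flow A s b $ 0 - norm (spatial (flow A s b))" for s
  have flow_cont: "continuous_on {0..1} (\<lambda>s. flow A s b)"
    by (intro continuous_at_imp_continuous_on ballI)
      (rule has_vector_derivative_continuous[OF flow_has_vector_derivative])
  have "continuous_on {0..1} gap"
    unfolding gap_def
    by (intro continuous_intros continuous_on_component flow_cont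
        linear_continuous_on_compose[OF flow_cont linear_spatial])
  \<comment> \<open>The minimum of the gap over the compact interval is the constant sought; it
    depends on neither \<open>m\<close> nor \<open>q\<close>.\<close>
  then obtain s0 where s0: "\<And>s. s \<in> {0..1} \<Longrightarrow> gap s0 \<le> gap s"
    using continuous_attains_inf[of "{0..1::real}" gap] by (metis atLeastAtMost_iff compact_Icc empty_iff order_refl zero_le_one)
  show ?thesis
  proof
    have "timelike (flow A s0 b)"
      using assms by (simp add: timelike_def)
    then show "gap s0 > 0"
      using flow_future[OF assms, of s0] by (simp add: gap_def timelike_iff)
  next
    fix m q assume "on_shell m q"
    then have q: "minkowski q q \<ge> 0" "q $ 0 \<ge> 0"
      by (simp_all add: on_shell_iff)
    have "((\<lambda>s. minkowski (flow_integral A s b) q) has_real_derivative minkowski (flow A s b) q) (at s)" for s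
      using bounded_linear.has_vector_derivative[OF minkowski.bounded_linear_left
          flow_integral_has_vector_derivative]
      by (simp add: has_real_derivative_iff_has_vector_derivative)
    \<comment> \<open>Since \<open>flow_integral\<close> vanishes at time \<open>0\<close>, the mean
      value theorem replaces the integral by one value of its integrand.\<close>
    from MVT2[of 0 1, OF _ this] obtain s where "0 < s" "s < 1"
      and s: "minkowski (flow_integral A 1 b) q = minkowski (flow A s b) q"
      by (auto simp: minkowski.zero_left)
    have "gap s0 * q $ 0 \<le> gap s * q $ 0"
      using s0[of s] \<open>0 < s\<close> \<open>s < 1\<close> q by (intro mult_right_mono) auto
    also have "\<dots> \<le> minkowski (flow A s b) q"
      unfolding gap_def using q by (rule minkowski_ge_gap)
    finally show "gap s0 * q $ 0 \<le> minkowski (flow_integral A 1 b) q"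
      using s by simp
  qed
qed

section \<open>Equality of the two exponents\<close>

lemma minkowski_flow_integral_step:
  "minkowski (flow_integral A 1 b) (flow A t p)
     = minkowski b (flow_integral A t p) - minkowski b (flow_integral A (t - 1) p)"
proof -
  \<comment> \<open>The first summand is the integral of \<open>minkowski b (flow A u p)\<close>
    over \<open>u\<close> from \<open>t - r\<close> to \<open>t\<close>, the second from
    \<open>0\<close> to \<open>t - r\<close>, so the sum does not depend on
    \<open>r\<close>.\<close>
  define D where
    "D r = minkowski (flow_integral A r b) (flow A t p) + minkowski b (flow_integral A (t - r) p)" for r
  have backwards:
    "((\<lambda>r. flow_integral A (t - r) p) has_vector_derivative - flow A (t - r) p) (at r)" for r
  proof -
    have "((\<lambda>r. t - r) has_vector_derivative - 1) (at r)"
      by (auto intro!: derivative_eq_intros)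
    from vector_diff_chain_at[OF this flow_integral_has_vector_derivative] show ?thesis
      by (simp add: o_def)
  qed
  have "minkowski (flow A r b) (flow A t p) = minkowski b (flow A (t - r) p)" for r
    using minkowski_flow_flow[of r b "t - r" p] by simp
  then have "(D has_vector_derivative 0) (at r)" for r
    unfolding D_def
    using has_vector_derivative_add[OF
        bounded_linear.has_vector_derivative[OF minkowski.bounded_linear_left[of "flow A t p"]
          flow_integral_has_vector_derivative[of A b r]]
        bounded_linear.has_vector_derivative[OF minkowski.bounded_linear_right[of b] backwards[of r]]]
    by (simp add: minkowski.minus_right)
  then obtain c where "D r = c" for r
    by (rule has_vector_derivative_zero_constant[OF convex_UNIV]) auto
  then have "D 1 = D 0"
    by simp
  then show ?thesis
    by (simp add: D_def minkowski.zero_left)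
qed

lemma sum_minkowski_flow:
  "(\<Sum>k = 1..n. minkowski (flow_integral A 1 b) (flow A (real k) p))
     = minkowski b (flow_integral A (real n) p)"
  by (induction n) (simp_all add: minkowski_flow_integral_step minkowski.zero_right)

lemma mat_pow_minkowski: "minkowski (mat_pow A k *v x) y = (- 1) ^ k * minkowski x (mat_pow A k *v y)"
proof (induction k arbitrary: y)
  case (Suc k)
  \<comment> \<open>Powers are built by multiplication on the left, but moving \<open>A\<close>
    across the product leaves it on the right.\<close>
  have "mat_pow A k *v (A *v y) = A *v (mat_pow A k *v y)" for y
    by (induction k) (simp_all flip: matrix_vector_mul_assoc)
  then show ?case
    by (simp add: matrix_vector_mul_assoc[symmetric] skew Suc.IH)
qed simp

text \<open>The series agree term by term: moving \<open>mat_pow A j\<close> across costs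
  \<open>(- 1) ^ j\<close>, which cancels the sign in \<open>(- s) ^ j\<close>, and the outer
  \<open>s\<close> supplies the missing power.\<close>

lemma minkowski_flow_integral_scaled:
  "s * minkowski (flow_integral ((- s) *\<^sub>R A) 1 b) p = minkowski b (flow_integral A s p)"
proof -
  have scaled: "mat_pow (r *\<^sub>R A) k *v b = r ^ k *\<^sub>R (mat_pow A k *v b)" for r k
    by (induction k)
      (simp_all add: matrix_vector_mul_assoc[symmetric] matrix_vector_mult_scaleR
        scaleR_matrix_vector_assoc[symmetric] mult.commute)
  let ?c = "case_nat 0 (\<lambda>k. mat_pow ((- s) *\<^sub>R A) k *v b)"
  let ?d = "case_nat 0 (\<lambda>k. mat_pow A k *v p)"
  have "(\<lambda>k. s * minkowski ((1 ^ k / fact k) *\<^sub>R ?c k) p) sums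
      (s * minkowski (flow_integral ((- s) *\<^sub>R A) 1 b) p)"
    unfolding flow_integral_def
    by (intro sums_mult bounded_linear.sums[OF minkowski.bounded_linear_left] egf_sums
        geometrically_bounded_case_nat geometrically_bounded_orbit)
  moreover have "(\<lambda>k. minkowski b ((s ^ k / fact k) *\<^sub>R ?d k)) sums minkowski b (flow_integral A s p)"
    unfolding flow_integral_def
    by (intro bounded_linear.sums[OF minkowski.bounded_linear_right] egf_sums
        geometrically_bounded_case_nat geometrically_bounded_orbit)
  moreover have "s * minkowski ((1 ^ k / fact k) *\<^sub>R ?c k) p = minkowski b ((s ^ k / fact k) *\<^sub>R ?d k)" for k
  proof (cases k)
    case (Suc j)
    have "(- s) ^ j * minkowski (mat_pow A j *v b) p = s ^ j * minkowski b (mat_pow A j *v p)"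
      by (simp add: mat_pow_minkowski mult.assoc[symmetric] flip: power_mult_distrib)
    then show ?thesis
      by (simp add: Suc scaled[of "- s", simplified] minkowski.scaleR_left minkowski.scaleR_right)
  qed (simp add: minkowski.zero_left minkowski.zero_right)
  ultimately show ?thesis
    by (simp add: sums_unique2)
qed

end

section \<open>The series\<close>

text \<open>The Minkowski product lowers the raised index again, which leaves the Euclidean form of
  the antisymmetric \<open>\<phi>\<close>.\<close>

lemma minkowski_skew_mixed:
  assumes "antisymmetric \<phi>"
  shows "minkowski_skew (mixed \<phi>)"
proof
  fix x y
  have involution: "metric *v (metric *v z) = z" for z
    by (simp add: vec_eq_iff metric_mult_vec)
  have "transpose \<phi> $ \<mu> $ \<nu> = (- \<phi>) $ \<mu> $ \<nu>" for \<mu> \<nu>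
    using assms[unfolded antisymmetric_def, rule_format, of \<nu> \<mu>] by (simp add: transpose_def)
  then have "transpose \<phi> = - \<phi>"
    by (simp add: vec_eq_iff)
  moreover have neg_mult: "(- \<phi>) *v z = - (\<phi> *v z)" for z
    by (simp add: matrix_vector_mult_def vec_eq_iff sum_negf)
  ultimately have "x v* \<phi> = - (\<phi> *v x)"
    by (metis transpose_matrix_vector)
  then have "(\<phi> *v x) \<bullet> y = - (x \<bullet> (\<phi> *v y))"
    using dot_lmul_matrix[of x \<phi> y] by simp
  moreover have "(metric *v (\<phi> *v x)) \<bullet> (metric *v y) = (\<phi> *v x) \<bullet> y"
    unfolding inner_vec_def metric_mult_vec by (rule sum.cong) auto
  ultimately show "minkowski (mixed \<phi> *v x) y = - minkowski x (mixed \<phi> *v y)"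
    by (simp add: minkowski_def mixed_def matrix_vector_mul_assoc[symmetric] involution)
qed

section \<open>Bounded test functions and a summability criterion\<close>

lemma test_function_bounded:
  assumes "test_function f"
  obtains M where "\<And>x. \<bar>f x\<bar> \<le> M"
proof -
  let ?K = "closure {x. f x \<noteq> 0}"
  have "compact (f ` ?K)"
    using assms continuous_on_subset[OF _ subset_UNIV, of f ?K]
    unfolding test_function_def by (intro compact_continuous_image) blast+
  then obtain M where M: "\<And>x. x \<in> ?K \<Longrightarrow> \<bar>f x\<bar> \<le> M"
    using compact_imp_bounded[of "f ` ?K"] by (auto simp: bounded_iff)
  have "\<bar>f x\<bar> \<le> \<bar>M\<bar>" for x
  proof (cases "f x = 0")
    case False
    then have "x \<in> ?K"
      using closure_subset[of "{x. f x \<noteq> 0}"] by (simp add: subset_iff)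
    then show ?thesis
      using M[of x] by linarith
  qed simp
  then show ?thesis
    by (rule that)
qed

text \<open>Each term is dominated by a telescoping difference, since \<open>x e\<^sup>-\<^sup>x \<le> 1 - e\<^sup>-\<^sup>x\<close>.\<close>

lemma summable_times_exp_neg_sum:
  fixes a :: "nat \<Rightarrow> real"
  assumes "\<And>n. a n \<ge> 0"
  shows "summable (\<lambda>n. a n * exp (- (\<Sum>k\<le>n. a k)))"
proof -
  define g where "g n = exp (- (\<Sum>k<n. a k))" for n
  have "decseq g"
    unfolding g_def decseq_Suc_iff using assms by simp
  then obtain L where "g \<longlonglongrightarrow> L"
    by (rule decseq_convergent[of g 0]) (auto simp: g_def)
  then have "summable (\<lambda>n. g n - g (Suc n))"
    by (rule telescope_summable')
  moreover have "norm (a n * exp (- (\<Sum>k\<le>n. a k))) \<le> g n - g (Suc n)" for n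
  proof -
    have "(1 + a n) * g (Suc n) \<le> exp (a n) * g (Suc n)"
      by (intro mult_right_mono exp_ge_add_one_self) (simp add: g_def)
    also have "\<dots> = g n"
      by (simp add: g_def exp_add[symmetric])
    finally show ?thesis
      using assms by (simp add: g_def lessThan_Suc_atMost algebra_simps)
  qed
  ultimately show ?thesis
    by (rule summable_comparison_test'[where N=0])
qed

section \<open>Terms along an orbit, convergence and the equation\<close>

context
  fixes \<phi> :: "real ^ 4 ^ 4"
  assumes antisym: "antisymmetric \<phi>"
begin

interpretation minkowski_skew "mixed \<phi>"
  by (rule minkowski_skew_mixed[OF antisym])

text \<open>The transported momentum stays on shell, so its energy in the prefactor is its time
  component.\<close>

lemma S_term_eq:
  assumes "on_shell m p"
  shows "S_term m b \<phi> p n f =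
    exp (- (\<Sum>k = 1..n. minkowski (btilde \<phi> b) (flow (mixed \<phi>) (real k) p)))
    * (2 * flow (mixed \<phi>) (real n) p $ 0 * f (spatial (flow (mixed \<phi>) (real n) p)))"
  using on_shell_flow[OF assms, of n]
  by (simp add: S_term_def fun_times_def delta_def lorentz_def minkowski_inverse_power mat_pow_mat_exp
      on_shell_def)

text \<open>Both exponents are minus
  \<open>minkowski b (flow_integral (mixed \<phi>) (real n) p)\<close>.\<close>

lemma S_term_eq_alt: "S_term m b \<phi> p n f = S_term_alt m b \<phi> p n f"
  unfolding S_term_def S_term_alt_def lorentz_def minkowski_inverse_power btilde_def btilde_n_def
    averaged_eq_flow_integral sum_minkowski_flow minkowski_flow_integral_scaled ..

lemma S_convergent_future:
  assumes b: "timelike b" "b $ 0 > 0" and p: "on_shell m p" and f: "test_function f"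
  shows "S_convergent m b \<phi> p f"
proof -
  let ?q = "\<lambda>k. flow (mixed \<phi>) (real k) p"
  obtain M where M: "\<And>x. \<bar>f x\<bar> \<le> M"
    using test_function_bounded[OF f] by blast
  obtain c where c: "c > 0"
    and coercive: "\<And>m q. on_shell m q \<Longrightarrow> c * q $ 0 \<le> minkowski (btilde \<phi> b) q"
    using flow_integral_coercive[OF b] unfolding btilde_def averaged_eq_flow_integral by blast
  \<comment> \<open>The index is shifted by one because the sum in the exponent starts at
    \<open>k = 1\<close>.\<close>
  define a where "a k = c * ?q (Suc k) $ 0" for k
  have nonneg: "?q k $ 0 \<ge> 0" for k
    using on_shell_flow[OF p] by (simp add: on_shell_iff)
  then have "a k \<ge> 0" for k
    using c by (simp add: a_def del: of_nat_Suc)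
  then have "summable (\<lambda>n. (2 * M / c) * (a n * exp (- (\<Sum>k\<le>n. a k))))"
    by (intro summable_mult summable_times_exp_neg_sum)
  moreover have "norm (S_term m b \<phi> p (Suc n) f) \<le> (2 * M / c) * (a n * exp (- (\<Sum>k\<le>n. a k)))" for n
  proof -
    let ?E = "\<Sum>k = 1..Suc n. minkowski (btilde \<phi> b) (?q k)"
    have "(\<Sum>k\<le>n. a k) = (\<Sum>k = 1..Suc n. c * ?q k $ 0)"
      unfolding a_def One_nat_def sum.shift_bounds_cl_Suc_ivl by (simp add: atMost_atLeast0)
    also have "\<dots> \<le> ?E"
      by (intro sum_mono coercive[of m] on_shell_flow[OF p])
    finally have "exp (- ?E) \<le> exp (- (\<Sum>k\<le>n. a k))"
      by simp
    moreover have "2 * ?q (Suc n) $ 0 * \<bar>f (spatial (?q (Suc n)))\<bar> \<le> 2 * ?q (Suc n) $ 0 * M"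
      using nonneg[of "Suc n"] M by (intro mult_left_mono) auto
    ultimately have "exp (- ?E) * (2 * ?q (Suc n) $ 0 * \<bar>f (spatial (?q (Suc n)))\<bar>)
        \<le> exp (- (\<Sum>k\<le>n. a k)) * (2 * ?q (Suc n) $ 0 * M)"
      by (rule mult_mono) (use nonneg[of "Suc n"] in \<open>simp_all del: of_nat_Suc\<close>)
    also have "\<dots> = (2 * M / c) * (a n * exp (- (\<Sum>k\<le>n. a k)))"
      using c by (simp add: a_def field_simps)
    finally show ?thesis
      using nonneg[of "Suc n"] unfolding S_term_eq[OF p] by (simp add: abs_mult)
  qed
  ultimately show ?thesis
    unfolding S_convergent_def by (rule summable_comparison_test'[where N=0])
qed

text \<open>Starting one step later on the orbit reaches the same points; only the
  \<open>k = 1\<close> part of the exponent is lost, and it becomes the prefactor.\<close>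

lemma S_term_Suc:
  assumes "on_shell m p"
  shows "S_term m b \<phi> p (Suc n) f
    = exp (- minkowski (btilde \<phi> b) (lorentz \<phi> *v p)) * S_term m b \<phi> (lorentz \<phi> *v p) n f"
proof -
  let ?A = "mixed \<phi>"
  have shift: "flow ?A (real k) (flow ?A 1 p) = flow ?A (real (Suc k)) p" for k
    by (simp add: flow_add[symmetric] add.commute)
  have "(\<Sum>k = 1..Suc n. minkowski (btilde \<phi> b) (flow ?A (real k) p))
      = minkowski (btilde \<phi> b) (flow ?A 1 p)
        + (\<Sum>k = 1..n. minkowski (btilde \<phi> b) (flow ?A (real (Suc k)) p))"
    using sum.atLeast_Suc_atMost[of 1 "Suc n" "\<lambda>k. minkowski (btilde \<phi> b) (flow ?A (real k) p)"]
      sum.shift_bounds_cl_Suc_ivl[of "\<lambda>k. minkowski (btilde \<phi> b) (flow ?A (real k) p)" 1 n]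
    by simp
  then show ?thesis
    unfolding S_term_eq[OF assms] lorentz_def mat_exp_mult_vec
      S_term_eq[OF on_shell_flow[OF assms]] shift
    by (simp add: exp_add[symmetric] mult.assoc[symmetric] del: of_nat_Suc)
qed

lemma S_solves_equation:
  assumes p: "on_shell m p" and conv: "S_convergent m b \<phi> p f"
  shows "S_convergent m b \<phi> (lorentz \<phi> *v p) f" and "equation_at m b \<phi> (S m b \<phi>) p f"
proof -
  define w where "w = exp (- minkowski (btilde \<phi> b) (lorentz \<phi> *v p))"
  have "summable (\<lambda>n. w * S_term m b \<phi> (lorentz \<phi> *v p) n f)"
    using conv unfolding S_convergent_def S_term_Suc[OF p] w_def .
  then have summable0: "summable (\<lambda>n. S_term m b \<phi> (lorentz \<phi> *v p) n f)"
    by (simp add: w_def summable_mult_D)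
  then show "S_convergent m b \<phi> (lorentz \<phi> *v p) f"
    unfolding S_convergent_def by (rule summable_Suc_iff[THEN iffD2])
  have "on_shell m (lorentz \<phi> *v p)"
    using on_shell_flow[OF p, of 1] by (simp add: lorentz_def mat_exp_mult_vec)
  \<comment> \<open>At the point of the delta, \<open>shell_vec m p'\<close> is
    \<open>lorentz \<phi> *v p\<close> itself, so the exponential in the source term equals
    \<open>w\<close>.\<close>
  note shell = shell_vec_spatial[OF this]
  have "S m b \<phi> p f = w * (\<Sum>n. S_term m b \<phi> (lorentz \<phi> *v p) n f)"
    unfolding S_def S_term_Suc[OF p] w_def[symmetric] by (rule suminf_mult[OF summable0])
  \<comment> \<open>The index-\<open>0\<close> term has an empty exponent; multiplied by
    \<open>w\<close> it is the source term of the equation.\<close>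
  also have "\<dots> = w * S m b \<phi> (lorentz \<phi> *v p) f + w * S_term m b \<phi> (lorentz \<phi> *v p) 0 f"
    unfolding S_def by (simp add: suminf_split_head[OF summable0] algebra_simps)
  finally show "equation_at m b \<phi> (S m b \<phi>) p f"
    by (simp add: equation_at_def S_term_def fun_times_def delta_def shell w_def mult_ac)
qed

end

text \<open>Convergence is claimed for future-directed \<open>b\<close>; the equation is asserted
  wherever the series converges at \<open>p\<close>, for either time direction of
  \<open>b\<close>.\<close>

theorem mainTheorem3:
  fixes m :: real and b :: fourvec and \<phi> :: "real ^ 4 ^ 4"
  assumes "m \<ge> 0" and "timelike b" and "antisymmetric \<phi>"
  shows "(b $ 0 > 0 \<longrightarrow>
            (\<forall>p f. on_shell m p \<and> test_function f \<longrightarrow> S_convergent m b \<phi> p f))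
       \<and> (\<forall>p f. on_shell m p \<and> test_function f \<longrightarrow>
            (\<forall>n\<ge>1. S_term m b \<phi> p n f = S_term_alt m b \<phi> p n f) \<and> S m b \<phi> p f = S_alt m b \<phi> p f)
       \<and> (\<forall>p f. on_shell m p \<and> test_function f \<and> S_convergent m b \<phi> p f \<longrightarrow>
            S_convergent m b \<phi> (lorentz \<phi> *v p) f \<and> equation_at m b \<phi> (S m b \<phi>) p f)"
  using S_convergent_future[OF assms(3,2)] S_term_eq_alt[OF assms(3)] S_solves_equation[OF assms(3)]
  by (auto simp: S_def S_alt_def)

end
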